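(* Any algorithm that PAC learns all self-bounding functions from $\{0,1\}^n$ to $[0,1]$ over the uniform distribution with $\ell_2$ error $\epsilon>0$ requires $2^{\Omega(1/\epsilon^2)}$ random examples of (or value queries to) the target function.
   Context: A function $f:\{0,1\}^n\to\mathbb{R}$ is self-bounding if it is $1$-Lipschitz (with respect to Hamming distance) and for all $x\in\{0,1\}^n$, $\sum_{i=1}^n(f(x)-f(x\oplus e_i))_+\le f(x)$, where $x\oplus e_i$ is $x$ with the $i$-th bit flipped and $(\alpha)_+=\max\{0,\alpha\}$. An algorithm PAC learns a class $\mathcal{F}$ with $\ell_2$ error $\epsilon$ over the uniform distribution if for every target $f\in\mathcal{F}$, given independent examples $(x,f(x))$ with $x$ uniform, with probability at least $2/3$ it outputs $h$ with $\sqrt{\mathbb{E}_x[(f(x)-h(x))^2]}\le\epsilon$. A value query returns $f(x)$ for a point $x$ chosen by the algorithm.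
   Formalization: The bound is proved for all sufficiently small ε and every n ≥ 1/ε²; some condition on n is needed, since for fixed n (e.g. n = 1) 2^n value queries always suffice, however small ε is. *)

theory Defs
  imports "HOL-Probability.Probability"
begin

(* Points of {0,1}^n are the Boolean lists of length n.  Functions on the cube are functions on
   all Boolean lists; their values off the cube are never used. *)

definition cube :: "nat \<Rightarrow> bool list set" where
  "cube n = {x. length x = n}"

definition flip_bit :: "nat \<Rightarrow> bool list \<Rightarrow> bool list" where
  "flip_bit i x = x[i := \<not> x ! i]"

definition hamming_dist :: "nat \<Rightarrow> bool list \<Rightarrow> bool list \<Rightarrow> nat" where
  "hamming_dist n x y = card {i. i < n \<and> x ! i \<noteq> y ! i}"

definition self_bounding :: "nat \<Rightarrow> (bool list \<Rightarrow> real) \<Rightarrow> bool" where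
  "self_bounding n f \<longleftrightarrow>
     (\<forall>x\<in>cube n. \<forall>y\<in>cube n. \<bar>f x - f y\<bar> \<le> real (hamming_dist n x y)) \<and>
     (\<forall>x\<in>cube n. (\<Sum>i<n. max 0 (f x - f (flip_bit i x))) \<le> f x)"

definition self_bounding_unit :: "nat \<Rightarrow> (bool list \<Rightarrow> real) set" where
  "self_bounding_unit n = {f. self_bounding n f \<and> (\<forall>x\<in>cube n. f x \<in> {0..1})}"

definition l2_error :: "nat \<Rightarrow> (bool list \<Rightarrow> real) \<Rightarrow> (bool list \<Rightarrow> real) \<Rightarrow> real" where
  "l2_error n f h =
     sqrt (measure_pmf.expectation (pmf_of_set (cube n)) (\<lambda>x. (f x - h x)\<^sup>2))"

(* Algorithms may be randomized and are computationally unbounded: the internal randomness is a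
   bit sequence drawn from an arbitrary probability space M, and for each such seed the algorithm
   is deterministic.  The seed type is fixed, not a type variable, so that constants in a lower
   bound cannot depend on it.  Non-measurable sets have measure 0 in the library, so the
   probability bounds below entail measurability of the success events. *)

type_synonym seed = "nat \<Rightarrow> bool"

definition learns_from_examples ::
  "nat \<Rightarrow> (bool list \<Rightarrow> real) set \<Rightarrow> real \<Rightarrow> nat \<Rightarrow> seed measure
    \<Rightarrow> (seed \<Rightarrow> (bool list \<times> real) list \<Rightarrow> (bool list \<Rightarrow> real)) \<Rightarrow> bool" where
  "learns_from_examples n F \<epsilon> q M A \<longleftrightarrow>
     prob_space M \<and>
     (\<forall>f\<in>F. \<P>(p in M \<Otimes>\<^sub>M measure_pmf (replicate_pmf q (pmf_of_set (cube n))).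
        l2_error n f (A (fst p) (map (\<lambda>x. (x, f x)) (snd p))) \<le> \<epsilon>) \<ge> 2 / 3)"

(* A deterministic adaptive strategy: either stop with a hypothesis, or query a point and
   continue depending on the answer. *)

datatype strategy =
    Output "bool list \<Rightarrow> real"
  | Query "bool list" "real \<Rightarrow> strategy"

primrec output_of :: "strategy \<Rightarrow> (bool list \<Rightarrow> real) \<Rightarrow> (bool list \<Rightarrow> real)" where
  "output_of (Output h) f = h"
| "output_of (Query x k) f = output_of (k (f x)) f"

primrec queried_points :: "strategy \<Rightarrow> (bool list \<Rightarrow> real) \<Rightarrow> bool list list" where
  "queried_points (Output h) f = []"
| "queried_points (Query x k) f = x # queried_points (k (f x)) f"

definition learns_from_queries ::
  "nat \<Rightarrow> (bool list \<Rightarrow> real) set \<Rightarrow> real \<Rightarrow> nat \<Rightarrow> seed measure \<Rightarrow> (seed \<Rightarrow> strategy) \<Rightarrow> bool" where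
  "learns_from_queries n F \<epsilon> q M A \<longleftrightarrow>
     prob_space M \<and>
     (\<forall>f\<in>F. \<forall>\<omega>\<in>space M. set (queried_points (A \<omega>) f) \<subseteq> cube n \<and>
                        length (queried_points (A \<omega>) f) \<le> q) \<and>
     (\<forall>f\<in>F. \<P>(\<omega> in M. l2_error n f (output_of (A \<omega>) f) \<le> \<epsilon>) \<ge> 2 / 3)"

end

theory Submission
  imports Defs
begin

text \<open>
  Let \<open>C\<close> be a code of minimum distance at least 3 and density at least \<open>1/(2k+1)\<close> in
  \<open>{0,1}\<^sup>k\<close>, where \<open>k\<close> is of order \<open>1/\<epsilon>\<^sup>2\<close>.  For every \<open>S \<subseteq> C\<close> the function on the cube that is 0
  where the first \<open>k\<close> bits lie in \<open>S\<close> and 1 elsewhere is self-bounding, since a point has at most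
  one neighbour in \<open>C\<close>.  Given the points seen by a deterministic learner on target \<open>S\<close>, replace \<open>S\<close>
  by its complement on the unseen codewords.  This is an involution on the subsets of \<open>C\<close> that does
  not change the output, and it moves the target by more than \<open>2\<epsilon>\<close> unless about half of \<open>C\<close> has
  been seen.  So the learner fails on at least half of all targets, and averaging over the seed
  gives a single target on which it succeeds with probability at most 1/2.
\<close>

section \<open>A code of minimum distance three\<close>

lemma finite_cube [simp]: "finite (cube n)"
  and card_cube: "card (cube n) = 2 ^ n"
proof -
  have "cube n = {xs. set xs \<subseteq> (UNIV :: bool set) \<and> length xs = n}"
    by (simp add: cube_def)
  then show "finite (cube n)" "card (cube n) = 2 ^ n"
    using finite_lists_length_eq[of "UNIV :: bool set" n] card_lists_length_eq[of "UNIV :: bool set" n]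
    by simp_all
qed

lemma cube_nonempty [simp]: "cube n \<noteq> {}"
  using card_cube[of n] by auto

lemma length_flip_bit [simp]: "length (flip_bit i x) = length x"
  by (simp add: flip_bit_def)

lemma take_flip_bit:
  "take k (flip_bit i x) = (if i < k then flip_bit i (take k x) else take k x)"
  by (auto simp: flip_bit_def take_update_swap list_update_beyond)

text \<open>The weighted checksum behind Varshamov-Tenengolts codes. Bit \<open>i\<close> has weight
  \<open>i + 1\<close> so that no weight is 0.\<close>

definition syndrome :: "nat \<Rightarrow> bool list \<Rightarrow> int" where
  "syndrome k x = (\<Sum>i<k. if x ! i then int i + 1 else 0)"

lemma syndrome_flip_bit:
  assumes "i < k" "length x = k"
  shows "syndrome k (flip_bit i x) = syndrome k x + (if x ! i then - (int i + 1) else int i + 1)"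
proof -
  have "syndrome k y = (if y ! i then int i + 1 else 0)
      + (\<Sum>j\<in>{..<k} - {i}. if y ! j then int j + 1 else 0)" for y
    unfolding syndrome_def using assms(1) by (subst sum.remove[of _ i]) auto
  moreover have "(\<Sum>j\<in>{..<k} - {i}. if flip_bit i x ! j then int j + 1 else 0)
      = (\<Sum>j\<in>{..<k} - {i}. if x ! j then int j + 1 else 0)"
    by (rule sum.cong) (auto simp: flip_bit_def)
  ultimately show ?thesis
    using assms by (simp add: flip_bit_def)
qed

text \<open>Stated through neighbours, this rules out codewords at distance exactly 2. Adjacent
  codewords are permitted: only points outside the chosen set must have few neighbours in
  it.\<close>

definition distance3_code :: "nat \<Rightarrow> bool list set \<Rightarrow> bool" where
  "distance3_code k C \<longleftrightarrow> C \<subseteq> cube k \<and>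
     (\<forall>x\<in>cube k. \<forall>i<k. \<forall>j<k. flip_bit i x \<in> C \<longrightarrow> flip_bit j x \<in> C \<longrightarrow> i = j)"

text \<open>Flipping bit \<open>i\<close> shifts the syndrome by \<open>i + 1\<close> up or down.
  For a fixed \<open>x\<close> these shifts have distinct absolute values and differ pairwise by
  less than \<open>2 * k + 1\<close>, so they stay distinct modulo \<open>2 * k + 1\<close>.\<close>

lemma syndrome_class_code:
  "distance3_code k {x \<in> cube k. syndrome k x mod (2 * int k + 1) = r}"
  unfolding distance3_code_def
proof (intro conjI ballI allI impI)
  fix x i j
  assume x: "x \<in> cube k" and ij: "i < k" "j < k"
    and C: "flip_bit i x \<in> {x \<in> cube k. syndrome k x mod (2 * int k + 1) = r}"
      "flip_bit j x \<in> {x \<in> cube k. syndrome k x mod (2 * int k + 1) = r}"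
  define d where "d l = (if x ! l then - (int l + 1) else int l + 1)" for l
  have "syndrome k (flip_bit i x) mod (2 * int k + 1) = syndrome k (flip_bit j x) mod (2 * int k + 1)"
    using C by simp
  then have "2 * int k + 1 dvd d i - d j"
    using x ij by (simp add: syndrome_flip_bit cube_def mod_eq_dvd_iff d_def)
  moreover have "\<bar>d i - d j\<bar> < 2 * int k + 1"
    using ij by (auto simp: d_def)
  ultimately have "d i = d j"
    using zdvd_imp_le[of "2 * int k + 1" "\<bar>d i - d j\<bar>"] by fastforce
  then show "i = j"
    by (auto simp: d_def split: if_splits)
qed auto

text \<open>Pigeonhole: the \<open>2 * k + 1\<close> residue classes of the syndrome cover the cube,
  so one of them has at least the average size.\<close>

lemma code_exists:
  obtains C where "distance3_code k C" "2 ^ k \<le> (2 * k + 1) * card C"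
proof -
  define m where "m = 2 * int k + 1"
  define C where "C r = {x \<in> cube k. syndrome k x mod m = r}" for r
  have "\<exists>r\<in>{0..<m}. 2 ^ k \<le> (2 * k + 1) * card (C r)"
  proof (rule ccontr)
    assume "\<not> ?thesis"
    then have less: "(2 * k + 1) * card (C r) < 2 ^ k" if "r \<in> {0..<m}" for r
      using that by force
    have "cube k = (\<Union>r\<in>{0..<m}. C r)"
      using pos_mod_bound[of m] by (auto simp: C_def m_def)
    then have "2 ^ k \<le> (\<Sum>r\<in>{0..<m}. card (C r))"
      using card_UN_le[of "{0..<m}" C] card_cube[of k] by simp
    then have "(2 * k + 1) * 2 ^ k \<le> (\<Sum>r\<in>{0..<m}. (2 * k + 1) * card (C r))"
      unfolding sum_distrib_left[symmetric] by (rule mult_le_mono2)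
    also have "\<dots> < (\<Sum>r\<in>{0..<m}. 2 ^ k)"
      by (rule sum_strict_mono) (use less in \<open>auto simp: m_def\<close>)
    also have "\<dots> = (2 * k + 1) * 2 ^ k"
      by (simp add: m_def nat_add_distrib nat_mult_distrib)
    finally show False
      by simp
  qed
  then show ?thesis
    using that syndrome_class_code unfolding C_def m_def by blast
qed

section \<open>Hard self-bounding functions\<close>

text \<open>The value on \<open>S\<close> is 0 and not 1 because the self-bounding sum counts
  downward steps: an isolated point of value 1 could have \<open>k\<close> of them. Bits after the
  first \<open>k\<close> are padding.\<close>

definition avoid :: "nat \<Rightarrow> bool list set \<Rightarrow> bool list \<Rightarrow> real" where
  "avoid k S x = (if take k x \<in> S then 0 else 1)"

lemma avoid_self_bounding:
  assumes C: "distance3_code k C" and S: "S \<subseteq> C" and "k \<le> n"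
  shows "avoid k S \<in> self_bounding_unit n"
  unfolding self_bounding_unit_def self_bounding_def mem_Collect_eq
proof (intro conjI ballI)
  fix x y
  assume xy: "x \<in> cube n" "y \<in> cube n"
  show "\<bar>avoid k S x - avoid k S y\<bar> \<le> real (hamming_dist n x y)"
  proof (cases "x = y")
    case False
    then obtain i where "i < n" "x ! i \<noteq> y ! i"
      using xy by (auto simp: cube_def list_eq_iff_nth_eq)
    then have "hamming_dist n x y > 0"
      by (auto simp: hamming_dist_def card_gt_0_iff)
    then show ?thesis
      by (auto simp: avoid_def)
  qed simp
next
  fix x
  assume x: "x \<in> cube n"
  show "(\<Sum>i<n. max 0 (avoid k S x - avoid k S (flip_bit i x))) \<le> avoid k S x"
  proof (cases "take k x \<in> S")
    case False
    define I where "I = {i. i < n \<and> take k (flip_bit i x) \<in> S}"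
    have tx: "take k x \<in> cube k"
      using x \<open>k \<le> n\<close> by (simp add: cube_def)
    \<comment> \<open>Flips of padding bits leave the prefix outside \<open>S\<close>, so only
      prefix flips count, and the code property allows at most one.\<close>
    have "i < k \<and> flip_bit i (take k x) \<in> C" if "i \<in> I" for i
      using that False S by (auto simp: I_def take_flip_bit split: if_splits)
    then have "i = j" if "i \<in> I" "j \<in> I" for i j
      using C tx that unfolding distance3_code_def by blast
    then have "card I \<le> 1"
      by (auto intro: card_le_Suc0_iff_eq[THEN iffD2] simp: I_def)
    moreover have "(\<Sum>i<n. max 0 (avoid k S x - avoid k S (flip_bit i x)))
        = (\<Sum>i<n. if take k (flip_bit i x) \<in> S then 1 else 0)"
      using False by (intro sum.cong) (auto simp: avoid_def)
    moreover have "\<dots> = real (card I)"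
      by (simp add: I_def sum.If_cases Int_def conj_commute)
    ultimately show ?thesis
      using False by (simp add: avoid_def)
  qed (simp add: avoid_def)
qed (simp add: avoid_def)

lemma card_cube_take:
  assumes "D \<subseteq> cube k" "k \<le> n"
  shows "card {x \<in> cube n. take k x \<in> D} = card D * 2 ^ (n - k)"
proof -
  have "bij_betw (\<lambda>(y, z). y @ z) (D \<times> cube (n - k)) {x \<in> cube n. take k x \<in> D}"
    by (rule bij_betw_byWitness[where f' = "\<lambda>x. (take k x, drop k x)"])
       (use assms in \<open>auto simp: cube_def subset_iff\<close>)
  then show ?thesis
    using bij_betw_same_card by (force simp: card_cartesian_product card_cube)
qed

lemma l2_error_le_iff:
  assumes "0 \<le> \<epsilon>"
  shows "l2_error n f h \<le> \<epsilon> \<longleftrightarrow> (\<Sum>x\<in>cube n. (f x - h x)\<^sup>2) \<le> \<epsilon>\<^sup>2 * 2 ^ n"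
proof -
  have "l2_error n f h \<le> \<epsilon> \<longleftrightarrow> (\<Sum>x\<in>cube n. (f x - h x)\<^sup>2) / 2 ^ n \<le> \<epsilon>\<^sup>2"
    using assms unfolding l2_error_def
    by (simp add: integral_pmf_of_set card_cube real_sqrt_le_iff' sum_nonneg)
  then show ?thesis
    by (simp add: divide_le_eq)
qed

text \<open>The squared distance of the two targets is the share of \<open>k\<close>-bit prefixes
  lying in \<open>sym_diff S S'\<close>. The factor 4 comes from (a - b)^2 \<le> 2 a^2 + 2
  b^2.\<close>

lemma avoid_close_imp_card_le:
  assumes "0 \<le> \<epsilon>" "S \<subseteq> cube k" "S' \<subseteq> cube k" "k \<le> n"
    and "l2_error n (avoid k S) h \<le> \<epsilon>" "l2_error n (avoid k S') h \<le> \<epsilon>"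
  shows "real (card (sym_diff S S')) \<le> 4 * \<epsilon>\<^sup>2 * 2 ^ k"
proof -
  have "real (card (sym_diff S S')) * 2 ^ (n - k)
      = (\<Sum>x\<in>cube n. if take k x \<in> sym_diff S S' then 1 else 0)"
    using card_cube_take[of "sym_diff S S'" k n] assms(2-4)
    by (subst sum.If_cases) (simp_all add: Int_def le_supI Diff_subset[THEN subset_trans])
  also have "\<dots> = (\<Sum>x\<in>cube n. (avoid k S x - avoid k S' x)\<^sup>2)"
    by (rule sum.cong) (auto simp: avoid_def)
  also have "\<dots> \<le> (\<Sum>x\<in>cube n. 2 * (avoid k S x - h x)\<^sup>2 + 2 * (avoid k S' x - h x)\<^sup>2)"
  proof (rule sum_mono)
    fix x
    have "0 \<le> ((avoid k S x - h x) + (avoid k S' x - h x))\<^sup>2"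
      by simp
    then show "(avoid k S x - avoid k S' x)\<^sup>2
        \<le> 2 * (avoid k S x - h x)\<^sup>2 + 2 * (avoid k S' x - h x)\<^sup>2"
      by (simp add: power2_eq_square algebra_simps)
  qed
  also have "\<dots> \<le> 4 * \<epsilon>\<^sup>2 * 2 ^ n"
    using assms by (simp add: l2_error_le_iff sum.distrib flip: sum_distrib_left)
  also have "\<dots> = 4 * \<epsilon>\<^sup>2 * 2 ^ k * 2 ^ (n - k)"
    using \<open>k \<le> n\<close> by (simp flip: power_add)
  finally show ?thesis
    by simp
qed

section \<open>Half of the targets are missed\<close>

text \<open>The injection sends successes to failures, so for almost every \<omega> at most half of
  \<S> succeeds. Integrating bounds the average success probability by 1/2. The injection may vary
  with \<omega>.\<close>

lemma (in prob_space) exists_prob_le_half: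
  assumes fin: "finite \<S>" "\<S> \<noteq> {}"
    and pairing: "AE \<omega> in M. \<exists>\<tau>. inj_on \<tau> \<S> \<and> \<tau> ` \<S> \<subseteq> \<S> \<and> (\<forall>S\<in>\<S>. P \<omega> S \<longrightarrow> \<not> P \<omega> (\<tau> S))"
  shows "\<exists>S\<in>\<S>. \<P>(\<omega> in M. P \<omega> S) \<le> 1 / 2"
proof (rule ccontr)
  assume "\<not> ?thesis"
  then have gt: "\<P>(\<omega> in M. P \<omega> S) > 1 / 2" if "S \<in> \<S>" for S
    using that by force
  define E where "E S = {\<omega> \<in> space M. P \<omega> S}" for S
  \<comment> \<open>A non-measurable set would have measure 0, so the assumed bound above 1/2 yields
    measurability.\<close>
  have [measurable]: "E S \<in> events" if "S \<in> \<S>" for S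
    using gt[OF that] measure_notin_sets[of "E S" M] by (force simp: E_def)
  have int: "integrable M (indicator (E S) :: _ \<Rightarrow> real)" if "S \<in> \<S>" for S
    using that by (intro integrable_real_indicator) (auto simp: emeasure_eq_measure)
  have "AE \<omega> in M. (\<Sum>S\<in>\<S>. indicator (E S) \<omega> :: real) \<le> card \<S> / 2"
    using pairing AE_space
  proof eventually_elim
    case (elim \<omega>)
    then obtain \<tau> where \<tau>: "inj_on \<tau> \<S>" "\<tau> ` \<S> \<subseteq> \<S>" "\<And>S. S \<in> \<S> \<Longrightarrow> P \<omega> S \<Longrightarrow> \<not> P \<omega> (\<tau> S)"
      by blast
    define G where "G = {S \<in> \<S>. P \<omega> S}"
    have "card G = card (\<tau> ` G)"
      using \<tau>(1) by (intro card_image[symmetric]) (auto simp: G_def inj_on_def)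
    also have "\<dots> \<le> card (\<S> - G)"
      using \<tau> fin by (intro card_mono) (auto simp: G_def)
    also have "\<dots> = card \<S> - card G"
      using fin by (intro card_Diff_subset) (auto simp: G_def)
    finally have "2 * card G \<le> card \<S>"
      using card_mono[of \<S> G] fin by (auto simp: G_def)
    moreover have "(\<Sum>S\<in>\<S>. indicator (E S) \<omega> :: real) = card G"
      using fin elim by (simp add: E_def G_def indicator_def sum.If_cases Int_def)
    ultimately show ?case
      by simp
  qed
  then have "(\<integral>\<omega>. (\<Sum>S\<in>\<S>. indicator (E S) \<omega>) \<partial>M) \<le> card \<S> / 2"
    using int by (intro integral_le_const) auto
  then have "(\<Sum>S\<in>\<S>. prob (E S)) \<le> card \<S> / 2"
    using int by (simp add: Bochner_Integration.integral_sum)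
  moreover have "(\<Sum>S\<in>\<S>. prob (E S)) > (\<Sum>S\<in>\<S>. 1 / 2)"
    using fin gt by (intro sum_strict_mono) (auto simp: E_def)
  ultimately show False
    by simp
qed

text \<open>
  Here \<open>H \<omega> S\<close> is the output on seed \<open>\<omega>\<close> and target \<open>S\<close>, and \<open>T S\<close> is the set of points seen, which
  may depend on earlier answers.
\<close>

lemma (in prob_space) hard_target_exists:
  assumes C: "C \<subseteq> cube k" and "k \<le> n" "0 \<le> \<epsilon>"
    and big: "real q + 4 * \<epsilon>\<^sup>2 * 2 ^ k < card C"
    and det: "AE \<omega> in M. \<exists>T. \<forall>S\<subseteq>C. finite (T S) \<and> card (T S) \<le> q \<and>
      (\<forall>S'\<subseteq>C. (\<forall>x\<in>T S. avoid k S' x = avoid k S x) \<longrightarrow> T S' = T S \<and> H \<omega> S' = H \<omega> S)"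
  shows "\<exists>S\<subseteq>C. \<P>(\<omega> in M. l2_error n (avoid k S) (H \<omega> S) \<le> \<epsilon>) \<le> 1 / 2"
proof -
  have "finite C"
    using C finite_subset finite_cube by blast
  have "\<exists>S\<in>Pow C. \<P>(\<omega> in M. l2_error n (avoid k S) (H \<omega> S) \<le> \<epsilon>) \<le> 1 / 2"
  proof (rule exists_prob_le_half)
    show "AE \<omega> in M. \<exists>\<tau>. inj_on \<tau> (Pow C) \<and> \<tau> ` Pow C \<subseteq> Pow C \<and>
      (\<forall>S\<in>Pow C. l2_error n (avoid k S) (H \<omega> S) \<le> \<epsilon> \<longrightarrow>
        \<not> l2_error n (avoid k (\<tau> S)) (H \<omega> (\<tau> S)) \<le> \<epsilon>)"
      using det
    proof eventually_elim
      case (elim \<omega>)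
      then obtain T where T: "\<And>S. S \<subseteq> C \<Longrightarrow> finite (T S) \<and> card (T S) \<le> q"
        and same: "\<And>S S'. S \<subseteq> C \<Longrightarrow> S' \<subseteq> C \<Longrightarrow> (\<forall>x\<in>T S. avoid k S' x = avoid k S x)
          \<Longrightarrow> T S' = T S \<and> H \<omega> S' = H \<omega> S"
        by metis
      define U where "U S = C - take k ` T S" for S
      define \<tau> where "\<tau> S = sym_diff S (U S)" for S
      have sub: "\<tau> S \<subseteq> C" if "S \<subseteq> C" for S
        using that by (auto simp: \<tau>_def U_def)
      \<comment> \<open>No seen point has its prefix in \<open>U S\<close>, so the swap changes no
        answer.\<close>
      have inv: "T (\<tau> S) = T S \<and> H \<omega> (\<tau> S) = H \<omega> S" if "S \<subseteq> C" for S
        by (rule same[OF that sub[OF that]]) (auto simp: avoid_def \<tau>_def U_def)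
      \<comment> \<open>Equal seen points give \<open>U (\<tau> S) = U S\<close>, so the second swap
        undoes the first.\<close>
      have "\<tau> (\<tau> S) = S" if "S \<subseteq> C" for S
        using inv[OF that] by (auto simp: \<tau>_def[of "\<tau> S"] U_def) (auto simp: \<tau>_def U_def)
      then have "inj_on \<tau> (Pow C)"
        by (intro inj_on_inverseI[of _ \<tau>]) auto
      moreover have "\<not> l2_error n (avoid k (\<tau> S)) (H \<omega> (\<tau> S)) \<le> \<epsilon>"
        if "S \<subseteq> C" "l2_error n (avoid k S) (H \<omega> S) \<le> \<epsilon>" for S
      proof
        assume "l2_error n (avoid k (\<tau> S)) (H \<omega> (\<tau> S)) \<le> \<epsilon>"
        then have "real (card (sym_diff S (\<tau> S))) \<le> 4 * \<epsilon>\<^sup>2 * 2 ^ k"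
          using that inv[of S] sub[of S] C \<open>k \<le> n\<close> \<open>0 \<le> \<epsilon>\<close>
          by (intro avoid_close_imp_card_le[where h = "H \<omega> S"]) auto
        moreover have "sym_diff S (\<tau> S) = U S"
          by (auto simp: \<tau>_def)
        moreover have "card C \<le> card (U S) + q"
        proof -
          have "card C - card (take k ` T S) \<le> card (U S)"
            unfolding U_def using T[OF that(1)] by (intro diff_card_le_card_Diff) auto
          moreover have "card (take k ` T S) \<le> q"
            using T[OF that(1)] card_image_le le_trans by blast
          ultimately show ?thesis
            by simp
        qed
        ultimately show False
          using big by simp
      qed
      ultimately show ?case
        using sub by (intro exI[of _ \<tau>]) auto
    qed
  qed (use \<open>finite C\<close> in auto)
  then show ?thesis
    by auto
qed

section \<open>Learners from examples and from queries\<close>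

lemma queries_determine_run:
  assumes "\<And>x. x \<in> set (queried_points s f) \<Longrightarrow> g x = f x"
  shows "queried_points s g = queried_points s f \<and> output_of s g = output_of s f"
  using assms by (induction s) auto

text \<open>The sample joins the seed as randomness, so \<open>hard_target_exists\<close> is applied
  on the product space.\<close>

lemma examples_lower_bound:
  assumes C: "distance3_code k C" and "k \<le> n" "0 \<le> \<epsilon>"
    and learns: "learns_from_examples n (self_bounding_unit n) \<epsilon> q M A"
  shows "card C \<le> real q + 4 * \<epsilon>\<^sup>2 * 2 ^ k"
proof (rule ccontr)
  assume big: "\<not> ?thesis"
  define R where "R = replicate_pmf q (pmf_of_set (cube n))"
  interpret M: prob_space M
    using learns by (simp add: learns_from_examples_def)
  interpret pair_prob_space M "measure_pmf R"
    by unfold_locales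
  \<comment> \<open>Lists outside the support of the sample distribution may have any length, hence
    only an almost-everywhere bound.\<close>
  have "AE z in M \<Otimes>\<^sub>M measure_pmf R. length (snd z) = q"
  proof (rule AE_pair_measure)
    show "{z \<in> space (M \<Otimes>\<^sub>M measure_pmf R). length (snd z) = q} \<in> sets (M \<Otimes>\<^sub>M measure_pmf R)"
      by measurable
    show "AE x in M. AE y in measure_pmf R. length (snd (x, y)) = q"
      by (rule AE_I2) (simp add: AE_measure_pmf_iff R_def set_replicate_pmf)
  qed
  then have det: "AE z in M \<Otimes>\<^sub>M measure_pmf R. \<exists>T. \<forall>S\<subseteq>C. finite (T S) \<and> card (T S) \<le> q \<and>
      (\<forall>S'\<subseteq>C. (\<forall>x\<in>T S. avoid k S' x = avoid k S x) \<longrightarrow> T S' = T S \<and>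
        A (fst z) (map (\<lambda>x. (x, avoid k S' x)) (snd z))
          = A (fst z) (map (\<lambda>x. (x, avoid k S x)) (snd z)))"
  proof eventually_elim
    case (elim z)
    then show ?case
      \<comment> \<open>The sample points do not depend on the target, so \<open>T\<close> is
        constant.\<close>
      by (intro exI[of _ "\<lambda>_. set (snd z)"]) (auto simp: card_length cong: map_cong)
  qed
  have "C \<subseteq> cube k"
    using C by (simp add: distance3_code_def)
  from hard_target_exists[OF this \<open>k \<le> n\<close> \<open>0 \<le> \<epsilon>\<close> _ det] big
  obtain S where "S \<subseteq> C" and
    "\<P>(z in M \<Otimes>\<^sub>M measure_pmf R.
        l2_error n (avoid k S) (A (fst z) (map (\<lambda>x. (x, avoid k S x)) (snd z))) \<le> \<epsilon>) \<le> 1 / 2"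
    by auto
  then show False
    using learns avoid_self_bounding[OF C \<open>S \<subseteq> C\<close> \<open>k \<le> n\<close>]
    unfolding learns_from_examples_def R_def by fastforce
qed

text \<open>Here the points seen depend on the target, but a run is fixed by the answers at its own
  queries. This is the consistency that \<open>hard_target_exists\<close> asks for.\<close>

lemma queries_lower_bound:
  assumes C: "distance3_code k C" and "k \<le> n" "0 \<le> \<epsilon>"
    and learns: "learns_from_queries n (self_bounding_unit n) \<epsilon> q M A"
  shows "card C \<le> real q + 4 * \<epsilon>\<^sup>2 * 2 ^ k"
proof (rule ccontr)
  assume big: "\<not> ?thesis"
  interpret prob_space M
    using learns by (simp add: learns_from_queries_def)
  have det: "AE \<omega> in M. \<exists>T. \<forall>S\<subseteq>C. finite (T S) \<and> card (T S) \<le> q \<and>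
      (\<forall>S'\<subseteq>C. (\<forall>x\<in>T S. avoid k S' x = avoid k S x) \<longrightarrow> T S' = T S \<and>
        output_of (A \<omega>) (avoid k S') = output_of (A \<omega>) (avoid k S))"
  proof (intro AE_I2 exI allI impI)
    fix \<omega> S
    assume "\<omega> \<in> space M" "S \<subseteq> C"
    then have "length (queried_points (A \<omega>) (avoid k S)) \<le> q"
      using learns avoid_self_bounding[OF C \<open>S \<subseteq> C\<close> \<open>k \<le> n\<close>] by (auto simp: learns_from_queries_def)
    then show "finite (set (queried_points (A \<omega>) (avoid k S))) \<and>
      card (set (queried_points (A \<omega>) (avoid k S))) \<le> q \<and>
      (\<forall>S'\<subseteq>C. (\<forall>x\<in>set (queried_points (A \<omega>) (avoid k S)). avoid k S' x = avoid k S x) \<longrightarrow>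
        set (queried_points (A \<omega>) (avoid k S')) = set (queried_points (A \<omega>) (avoid k S)) \<and>
        output_of (A \<omega>) (avoid k S') = output_of (A \<omega>) (avoid k S))"
      using queries_determine_run card_length le_trans by (metis finite_set)
  qed
  have "C \<subseteq> cube k"
    using C by (simp add: distance3_code_def)
  from hard_target_exists[OF this \<open>k \<le> n\<close> \<open>0 \<le> \<epsilon>\<close> _ det] big
  obtain S where "S \<subseteq> C" and
    "\<P>(\<omega> in M. l2_error n (avoid k S) (output_of (A \<omega>) (avoid k S)) \<le> \<epsilon>) \<le> 1 / 2"
    by auto
  then show False
    using learns avoid_self_bounding[OF C \<open>S \<subseteq> C\<close> \<open>k \<le> n\<close>]
    unfolding learns_from_queries_def by fastforce
qed

section \<open>Choice of the prefix length and numerical estimates\<close>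

lemma linear_le_exp:
  assumes "16 \<le> k"
  shows "(2 * (2 * real k + 1)) \<^sup>2 \<le> 2 ^ k"
  using assms
proof (induction k rule: dec_induct)
  case (step k)
  have "(2 * (2 * real (Suc k) + 1))\<^sup>2 \<le> 2 * (2 * (2 * real k + 1))\<^sup>2"
  proof -
    have "16 * real k \<le> real k * real k"
      using step by (intro mult_right_mono) auto
    then have "28 + real k * 16 \<le> real k * (real k * 16)"
      using step by linarith
    then show ?thesis
      by (simp add: power2_eq_square algebra_simps)
  qed
  then show ?case
    using step by simp
qed simp

text \<open>The choice of \<open>k\<close> makes \<open>4 * \<epsilon>\<^sup>2 * 2 ^ k\<close> at
  most half of the code size bound \<open>2 ^ k / (2 * k + 1)\<close>. The half left for
  \<open>q\<close> is at least \<open>2 powr (k / 2)\<close>.\<close>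

lemma exp_lower_bound:
  assumes "0 < \<epsilon>" "\<epsilon> \<le> 1 / 32" "k = nat \<lfloor>1 / (32 * \<epsilon>\<^sup>2)\<rfloor>"
    and code: "2 ^ k \<le> (2 * k + 1) * N" and le: "real N \<le> real q + 4 * \<epsilon>\<^sup>2 * 2 ^ k"
  shows "2 powr ((1 / 128) / \<epsilon>\<^sup>2) \<le> real q"
proof -
  define t where "t = 1 / (32 * \<epsilon>\<^sup>2)"
  have "\<epsilon>\<^sup>2 \<le> (1 / 32)\<^sup>2"
    using assms by (intro power_mono) auto
  then have t: "32 \<le> t"
    using assms(1) by (simp add: t_def field_simps power2_eq_square)
  have eps: "\<epsilon>\<^sup>2 = 1 / (32 * t)"
    by (simp add: t_def)
  have k: "real k \<le> t" "t - 1 \<le> real k"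
    using t unfolding assms(3) t_def[symmetric] by linarith+
  have "16 \<le> k"
    using k t by simp
  define m where "m = 2 * real k + 1"
  have "m > 0" "m \<le> 4 * t"
    using k t by (auto simp: m_def)
  have "4 * \<epsilon>\<^sup>2 * 2 ^ k = 2 ^ k / (8 * t)"
    by (simp add: eps)
  also have "\<dots> \<le> 2 ^ k / (2 * m)"
    using \<open>m > 0\<close> \<open>m \<le> 4 * t\<close> by (intro divide_left_mono) auto
  finally have 1: "4 * \<epsilon>\<^sup>2 * 2 ^ k \<le> 2 ^ k / (2 * m)" .
  have "(2::real) ^ k \<le> m * real N"
    using code unfolding m_def by (metis (mono_tags) of_nat_le_iff of_nat_mult of_nat_add
        of_nat_numeral of_nat_power of_nat_1)
  then have "2 ^ k / m \<le> real N"
    using \<open>m > 0\<close> by (simp add: divide_le_eq mult.commute)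
  then have q: "2 ^ k / (2 * m) \<le> real q"
    using 1 le by (simp add: field_simps)
  have "(2 * m)\<^sup>2 \<le> (2 powr (k / 2))\<^sup>2"
    using linear_le_exp[OF \<open>16 \<le> k\<close>]
    by (simp add: m_def powr_powr powr_realpow flip: powr_numeral)
  then have "2 * m \<le> 2 powr (k / 2)"
    by (rule power2_le_imp_le) simp
  then have "2 ^ k / 2 powr (k / 2) \<le> 2 ^ k / (2 * m)"
    using \<open>m > 0\<close> by (intro divide_left_mono) auto
  moreover have "2 ^ k / 2 powr (k / 2) = 2 powr (k / 2)"
    by (simp add: powr_realpow[symmetric] powr_diff[symmetric] flip: powr_diff)
  \<comment> \<open>Since \<open>t\<close> is at least 2, k / 2 \<ge> (t - 1) / 2 \<ge> t / 4, and
    \<open>t / 4\<close> is the exponent on the left; this fixes the constant 1/128.\<close>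
  moreover have "2 powr ((1 / 128) / \<epsilon>\<^sup>2) \<le> 2 powr (k / 2)"
    using k t by (intro powr_mono) (auto simp: eps)
  ultimately show ?thesis
    using q by linarith
qed

theorem theorem6p12:
  "\<exists>c::real. c > 0 \<and> (\<exists>\<epsilon>\<^sub>0::real. \<epsilon>\<^sub>0 > 0 \<and>
     (\<forall>(\<epsilon>::real) (n::nat) (q::nat).
        0 < \<epsilon> \<and> \<epsilon> \<le> \<epsilon>\<^sub>0 \<and> real n \<ge> 1 / \<epsilon>\<^sup>2 \<longrightarrow>
          (\<forall>M A. learns_from_examples n (self_bounding_unit n) \<epsilon> q M A
                   \<longrightarrow> real q \<ge> 2 powr (c / \<epsilon>\<^sup>2)) \<and>
          (\<forall>M A. learns_from_queries n (self_bounding_unit n) \<epsilon> q M A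
                   \<longrightarrow> real q \<ge> 2 powr (c / \<epsilon>\<^sup>2))))"
proof -
  have "(\<forall>M A. learns_from_examples n (self_bounding_unit n) \<epsilon> q M A
             \<longrightarrow> real q \<ge> 2 powr ((1 / 128) / \<epsilon>\<^sup>2)) \<and>
        (\<forall>M A. learns_from_queries n (self_bounding_unit n) \<epsilon> q M A
             \<longrightarrow> real q \<ge> 2 powr ((1 / 128) / \<epsilon>\<^sup>2))"
    if \<epsilon>: "0 < \<epsilon>" "\<epsilon> \<le> 1 / 32" and n: "1 / \<epsilon>\<^sup>2 \<le> real n" for \<epsilon> n q
  proof -
    define k where "k = nat \<lfloor>1 / (32 * \<epsilon>\<^sup>2)\<rfloor>"
    \<comment> \<open>The lower bound on \<open>n\<close> makes room for the \<open>k\<close> prefix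
      bits.\<close>
    have "real k \<le> 1 / (32 * \<epsilon>\<^sup>2)"
      by (simp add: k_def)
    also have "\<dots> \<le> 1 / \<epsilon>\<^sup>2"
      using \<epsilon>(1) by (simp add: field_simps)
    finally have "k \<le> n"
      using n by linarith
    obtain C where C: "distance3_code k C" "2 ^ k \<le> (2 * k + 1) * card C"
      by (rule code_exists)
    show ?thesis
      using exp_lower_bound[OF \<epsilon> k_def C(2)] examples_lower_bound[OF C(1) \<open>k \<le> n\<close>]
        queries_lower_bound[OF C(1) \<open>k \<le> n\<close>] \<epsilon>(1)
      by (meson less_imp_le)
  qed
  then show ?thesis
    by - (rule exI[of _ "1 / 128"], rule conjI, simp, rule exI[of _ "1 / 32"], rule conjI, simp, blast)
qed

end
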